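(* Consider a Markov renewal process on the state space $\{1,2,3\}$ with irreducible embedded Markov chain having transition matrix $P=[p_{ij}]$ and mean holding times $\mu_1,\mu_2,\mu_3$. Put $$\Delta_1=p_{21}p_{31}+p_{21}p_{32}+p_{23}p_{31},\quad \Delta_2=p_{12}p_{31}+p_{12}p_{32}+p_{13}p_{32},\quad \Delta_3=p_{13}p_{21}+p_{12}p_{23}+p_{13}p_{23}.$$ Then the mean first passage time matrix $M_3=[m_{ij}]$ is $$M_3=\begin{bmatrix}\dfrac{\Delta_1\mu_1+\Delta_2\mu_2+\Delta_3\mu_3}{\Delta_1}&\dfrac{(p_{31}+p_{32})\mu_1+p_{13}\mu_3}{\Delta_2}&\dfrac{(p_{21}+p_{23})\mu_1+p_{12}\mu_2}{\Delta_3}\\[2ex]\dfrac{(p_{31}+p_{32})\mu_2+p_{23}\mu_3}{\Delta_1}&\dfrac{\Delta_1\mu_1+\Delta_2\mu_2+\Delta_3\mu_3}{\Delta_2}&\dfrac{p_{21}\mu_1+(p_{12}+p_{13})\mu_2}{\Delta_3}\\[2ex]\dfrac{p_{32}\mu_2+(p_{21}+p_{23})\mu_3}{\Delta_1}&\dfrac{p_{31}\mu_1+(p_{12}+p_{13})\mu_3}{\Delta_2}&\dfrac{\Delta_1\mu_1+\Delta_2\mu_2+\Delta_3\mu_3}{\Delta_3}\end{bmatrix}.$$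
   Context: A Markov renewal process (MRP) $\{(X_k,T_k),k\ge0\}$, $T_0=0$, has semi-Markov kernel $Q_{ij}(t)=P\{X_{k+1}=j,T_{k+1}-T_k\le t\mid X_k=i\}$. The embedded Markov chain has transition matrix $P=[p_{ij}]$, $p_{ij}=Q_{ij}(+\infty)$; mean holding times $\mu_i=E[T_{k+1}-T_k\mid X_k=i]$ are assumed finite. The mean first passage time $m_{ij}$ is $E[T_\kappa\mid X_0=i]$ with $\kappa=\min\{k\ge1:X_k=j\}$ (the mean recurrence time if $i=j$); these are the unique solution of $m_{ij}=\mu_i+\sum_{k\ne j}p_{ik}m_{kj}$, $1\le i,j\le 3$. *)

theory Defs
  imports "HOL-Probability.Probability"
begin

text \<open>The sigma-algebra generated by \<open>X\<^sub>0, \<dots>, X\<^sub>k, T\<^sub>0, \<dots>, T\<^sub>k\<close>.\<close>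

definition history ::
  "'w measure \<Rightarrow> (nat \<Rightarrow> 'w \<Rightarrow> 's) \<Rightarrow> (nat \<Rightarrow> 'w \<Rightarrow> real) \<Rightarrow> nat \<Rightarrow> 'w measure" where
  "history M X T k =
     vimage_algebra (space M) (\<lambda>\<omega>. \<lambda>l\<in>{..k}. (X l \<omega>, T l \<omega>))
       (\<Pi>\<^sub>M l\<in>{..k}. count_space UNIV \<Otimes>\<^sub>M borel)"

text \<open>Given the whole history up to step \<open>k\<close>, the next state and holding time depend on the
  current state only, through the kernel \<open>Q\<close>, which does not depend on \<open>k\<close>. The
  initial distribution is arbitrary.\<close>

locale markov_renewal_process = prob_space M
  for M :: "'w measure" +
  fixes X :: "nat \<Rightarrow> 'w \<Rightarrow> 's::finite"
    and T :: "nat \<Rightarrow> 'w \<Rightarrow> real"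
    and Q :: "'s \<Rightarrow> 's \<Rightarrow> real \<Rightarrow> real"
  assumes measurable_X [measurable]: "\<And>k. X k \<in> measurable M (count_space UNIV)"
    and measurable_T [measurable]: "\<And>k. T k \<in> borel_measurable M"
    and T_0: "AE \<omega> in M. T 0 \<omega> = 0"
    and T_increasing: "\<And>k. AE \<omega> in M. T k \<omega> \<le> T (Suc k) \<omega>"
    and markov_renewal:
      "\<And>k j t. AE \<omega> in M.
         real_cond_exp M (history M X T k)
           (indicator {\<omega> \<in> space M. X (Suc k) \<omega> = j \<and> T (Suc k) \<omega> - T k \<omega> \<le> t}) \<omega>
         = Q (X k \<omega>) j t"

text \<open>The measure \<open>P(\<cdot> | X\<^sub>k = i)\<close>; meaningful only if \<open>X\<^sub>k = i\<close> has positive probability.\<close>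

definition given_state :: "'w measure \<Rightarrow> (nat \<Rightarrow> 'w \<Rightarrow> 's) \<Rightarrow> nat \<Rightarrow> 's \<Rightarrow> 'w measure" where
  "given_state M X k i = uniform_measure M {\<omega> \<in> space M. X k \<omega> = i}"

text \<open>\<open>\<mu> i\<close> is the (finite) value of \<open>E[T\<^sub>k\<^sub>+\<^sub>1 - T\<^sub>k | X\<^sub>k = i]\<close>, at every step \<open>k\<close> at which the
  state \<open>i\<close> can be occupied.\<close>

definition has_mean_holding_times ::
  "'w measure \<Rightarrow> (nat \<Rightarrow> 'w \<Rightarrow> 's) \<Rightarrow> (nat \<Rightarrow> 'w \<Rightarrow> real) \<Rightarrow> ('s \<Rightarrow> real) \<Rightarrow> bool" where
  "has_mean_holding_times M X T \<mu> \<longleftrightarrow>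
     (\<forall>k i. measure M {\<omega> \<in> space M. X k \<omega> = i} > 0 \<longrightarrow>
        has_bochner_integral (given_state M X k i) (\<lambda>\<omega>. T (Suc k) \<omega> - T k \<omega>) (\<mu> i))"

text \<open>\<open>T\<^sub>\<kappa>\<close> for \<open>\<kappa> = min {k \<ge> 1. X\<^sub>k = j}\<close>, with value \<open>\<infinity>\<close> if \<open>j\<close> is never entered.\<close>

definition first_passage_time ::
  "(nat \<Rightarrow> 'w \<Rightarrow> 's) \<Rightarrow> (nat \<Rightarrow> 'w \<Rightarrow> real) \<Rightarrow> 's \<Rightarrow> 'w \<Rightarrow> ennreal" where
  "first_passage_time X T j \<omega> =
     (if \<exists>k\<ge>1. X k \<omega> = j then ennreal (T (LEAST k. k \<ge> 1 \<and> X k \<omega> = j) \<omega>) else \<infinity>)"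

definition mean_first_passage_time ::
  "'w measure \<Rightarrow> (nat \<Rightarrow> 'w \<Rightarrow> 's) \<Rightarrow> (nat \<Rightarrow> 'w \<Rightarrow> real) \<Rightarrow> 's \<Rightarrow> 's \<Rightarrow> ennreal" where
  "mean_first_passage_time M X T i j =
     (\<integral>\<^sup>+ \<omega>. first_passage_time X T j \<omega> \<partial>given_state M X 0 i)"

text \<open>The power is taken with respect to the matrix product: the type class operations
  \<open>*\<close> and \<open>^\<close> are not the matrix ones.\<close>

definition irreducible_matrix :: "real^'n^'n \<Rightarrow> bool" where
  "irreducible_matrix P \<longleftrightarrow> (\<forall>i j. \<exists>n. (((**) P) ^^ n) (mat 1) $ i $ j > 0)"

end

theory Submission
  imports Defs
begin

text \<open>
  Let \<open>\<kappa>\<close> be the index of the first passage to \<open>j\<close>, and \<open>a\<^sub>k(s) = P(X\<^sub>0 = i, \<kappa> > k, X\<^sub>k = s)\<close>.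
  The Markov property gives \<open>a\<^sub>k\<^sub>+\<^sub>1(r) = \<Sum>s. p\<^sub>s\<^sub>r a\<^sub>k(s)\<close> for \<open>r \<noteq> j\<close> and
  \<open>E[T\<^sub>\<kappa>; X\<^sub>0 = i] = \<Sum>k s. \<mu>\<^sub>s a\<^sub>k(s)\<close>. Any solution of \<open>m\<^sub>s = \<mu>\<^sub>s + \<Sum>r\<noteq>j. p\<^sub>s\<^sub>r m\<^sub>r\<close> makes
  the last series telescope, with remainder \<open>\<Sum>s. m\<^sub>s a\<^sub>k(s)\<close>. A nonnegative solution for
  \<open>\<mu> = 1\<close> bounds \<open>\<Sum>k s. a\<^sub>k(s)\<close>, so the remainder vanishes in the limit and
  \<open>E[T\<^sub>\<kappa> | X\<^sub>0 = i] = m\<^sub>i\<close>. For three states the displayed matrix is such a solution.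
\<close>

section \<open>First passage in a Markov renewal process\<close>

text \<open>By induction on the exponent, no power of \<open>P\<close> leads out of a closed set.
  Each summand of the matrix product vanishes on its own, so the argument applies even before the
  entries are known to be nonnegative.\<close>

lemma irreducible_matrix_closed_set:
  fixes P :: "real^'n^'n"
  assumes irr: "irreducible_matrix P"
    and i: "i \<in> C"
    and closed: "\<And>r s. r \<in> C \<Longrightarrow> s \<notin> C \<Longrightarrow> P$r$s = 0"
  shows "C = UNIV"
proof (rule ccontr)
  assume "C \<noteq> UNIV"
  then obtain j where j: "j \<notin> C"
    by blast
  have "(((**) P) ^^ n) (mat 1) $ r $ j = 0" if "r \<in> C" for n r
    using that
  proof (induction n arbitrary: r)
    case 0
    then show ?case
      using j by (auto simp: mat_def)
  next
    case (Suc n)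
    have "P$r$s * ((((**) P) ^^ n) (mat 1) $ s $ j) = 0" for s
      using Suc closed by (cases "s \<in> C") auto
    moreover have "(P ** Y) $ r $ j = (\<Sum>s\<in>UNIV. P$r$s * Y$s$j)" for Y
      by (simp add: matrix_matrix_mult_def)
    ultimately show ?case
      by (auto intro!: sum.neutral)
  qed
  then show False
    using irr i unfolding irreducible_matrix_def by (metis less_irrefl)
qed

context markov_renewal_process
begin

section \<open>The history sigma-algebra and one-step laws given the past\<close>

lemma space_history [simp]: "space (history M X T k) = space M"
  by (simp add: history_def)

lemma subalgebra_history: "subalgebra M (history M X T k)"
proof -
  have "(\<lambda>\<omega>. \<lambda>l\<in>{..k}. (X l \<omega>, T l \<omega>))
      \<in> measurable M (\<Pi>\<^sub>M l\<in>{..k}. count_space UNIV \<Otimes>\<^sub>M borel)"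
    by measurable
  \<comment> \<open>Measurability of the identity into \<open>history\<close> amounts to the
    inclusion of its sets in \<open>events\<close>.\<close>
  then have id: "id \<in> measurable M (history M X T k)"
    unfolding history_def by (intro measurable_vimage_algebra2) auto
  have "A \<in> events" if "A \<in> sets (history M X T k)" for A
    using measurable_sets[OF id that] sets.sets_into_space[OF that] by (simp add: Int_absorb2)
  then show ?thesis
    by (auto simp: subalgebra_def)
qed

lemma sets_history_imp_event: "A \<in> sets (history M X T k) \<Longrightarrow> A \<in> events"
  using subalgebra_history[of k] by (auto simp: subalgebra_def)

lemma measurable_X_history:
  assumes "l \<le> k"
  shows "X l \<in> measurable (history M X T k) (count_space UNIV)"
proof -
  have *: "(\<lambda>\<omega>. \<lambda>l\<in>{..k}. (X l \<omega>, T l \<omega>))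
      \<in> measurable (history M X T k) (\<Pi>\<^sub>M l\<in>{..k}. count_space UNIV \<Otimes>\<^sub>M borel)"
    unfolding history_def by (intro measurable_vimage_algebra1) (auto simp: space_PiM space_pair_measure)
  have "(\<lambda>\<omega>. fst ((\<lambda>l\<in>{..k}. (X l \<omega>, T l \<omega>)) l))
      \<in> measurable (history M X T k) (count_space UNIV)"
    using measurable_compose[OF measurable_compose[OF * measurable_component_singleton] measurable_fst]
      assms by simp
  then show ?thesis
    using assms by simp
qed

lemma state_in_history:
  assumes "l \<le> k"
  shows "{\<omega> \<in> space M. X l \<omega> = s} \<in> sets (history M X T k)"
  using measurable_sets[OF measurable_X_history[OF assms], of "{s}"]
  by (auto simp: vimage_def Int_def conj_commute)

text \<open>On the past event \<open>B\<close> the current state is \<open>s\<close>, so the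
  conditional expectation is the constant \<open>Q s j t\<close> there; integrating it over
  \<open>B\<close> gives the claim. The product form also covers null events, on which no
  conditional probability is defined.\<close>

lemma prob_kernel:
  assumes A: "A \<in> sets (history M X T k)"
  shows "prob {\<omega> \<in> A. X k \<omega> = s \<and> X (Suc k) \<omega> = j \<and> T (Suc k) \<omega> - T k \<omega> \<le> t}
    = Q s j t * prob {\<omega> \<in> A. X k \<omega> = s}"
proof -
  interpret finite_measure_subalgebra M "history M X T k"
    by unfold_locales (rule subalgebra_history)
  define E where "E = {\<omega> \<in> space M. X (Suc k) \<omega> = j \<and> T (Suc k) \<omega> - T k \<omega> \<le> t}"
  define B where "B = A \<inter> {\<omega> \<in> space M. X k \<omega> = s}"
  have B: "B \<in> sets (history M X T k)"
    unfolding B_def using A state_in_history by blast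
  note [measurable] = sets_history_imp_event[OF B]
  have [measurable]: "E \<in> events"
    unfolding E_def by measurable
  have AM: "A \<subseteq> space M"
    using sets_history_imp_event[OF A] by (rule sets.sets_into_space)
  have "prob (B \<inter> E) = (\<integral>\<omega>\<in>B. indicator E \<omega> \<partial>M)"
    by (simp add: set_lebesgue_integral_def flip: indicator_inter_arith)
  also have "\<dots> = (\<integral>\<omega>\<in>B. real_cond_exp M (history M X T k) (indicator E) \<omega> \<partial>M)"
    using B by (intro real_cond_exp_intA) (simp_all add: emeasure_eq_measure)
  also have "\<dots> = (\<integral>\<omega>. Q s j t * indicator B \<omega> \<partial>M)"
    unfolding set_lebesgue_integral_def
  proof (rule integral_cong_AE)
    show "AE \<omega> in M. indicator B \<omega> *\<^sub>R real_cond_exp M (history M X T k) (indicator E) \<omega>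
        = Q s j t * indicator B \<omega>"
      using markov_renewal[of k j t] unfolding E_def[symmetric]
      by eventually_elim (auto simp: B_def indicator_def)
  qed measurable
  also have "\<dots> = Q s j t * prob B"
    by simp
  also have "B \<inter> E = {\<omega> \<in> A. X k \<omega> = s \<and> X (Suc k) \<omega> = j \<and> T (Suc k) \<omega> - T k \<omega> \<le> t}"
    using AM by (auto simp: B_def E_def)
  also have "B = {\<omega> \<in> A. X k \<omega> = s}"
    using AM by (auto simp: B_def)
  finally show ?thesis .
qed

text \<open>Letting the bound on the holding time tend to infinity turns the kernel identity into
  the Markov property of the embedded chain.\<close>

lemma prob_transition:
  assumes A: "A \<in> sets (history M X T k)"
    and lim: "(Q s j \<longlongrightarrow> p) at_top"
  shows "prob {\<omega> \<in> A. X k \<omega> = s \<and> X (Suc k) \<omega> = j} = p * prob {\<omega> \<in> A. X k \<omega> = s}"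
proof -
  define F where
    "F n = {\<omega> \<in> A. X k \<omega> = s \<and> X (Suc k) \<omega> = j \<and> T (Suc k) \<omega> - T k \<omega> \<le> real n}" for n :: nat
  note [measurable] = sets_history_imp_event[OF A]
  have "F n \<in> events" for n
    unfolding F_def by measurable
  moreover have "incseq F"
    by (auto simp: F_def incseq_def)
  ultimately have "(\<lambda>n. prob (F n)) \<longlonglongrightarrow> prob (\<Union>n. F n)"
    by (intro finite_Lim_measure_incseq) auto
  moreover have "(\<Union>n. F n) = {\<omega> \<in> A. X k \<omega> = s \<and> X (Suc k) \<omega> = j}"
    by (auto simp: F_def intro: real_arch_simple)
  moreover have "(\<lambda>n. prob (F n)) \<longlonglongrightarrow> p * prob {\<omega> \<in> A. X k \<omega> = s}"
    unfolding F_def prob_kernel[OF A]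
    by (intro tendsto_mult_right filterlim_compose[OF lim filterlim_real_sequentially])
  ultimately show ?thesis
    using LIMSEQ_unique by metis
qed

text \<open>Summing the kernel over the next state, the law of the holding time given \<open>X\<^sub>k = s\<close>
  does not change when one conditions further on an event of the past, as its distribution
  function is \<open>\<Sum>j. Q s j t\<close> either way.\<close>

lemma nn_integral_holding_time:
  assumes A: "A \<in> sets (history M X T k)"
    and \<mu>: "has_mean_holding_times M X T \<mu>"
  shows "(\<integral>\<^sup>+\<omega>. ennreal (T (Suc k) \<omega> - T k \<omega>) * indicator {\<omega> \<in> A. X k \<omega> = s} \<omega> \<partial>M)
    = ennreal (\<mu> s) * emeasure M {\<omega> \<in> A. X k \<omega> = s}"
proof (cases "prob {\<omega> \<in> A. X k \<omega> = s} = 0")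
  \<comment> \<open>The conditional law makes no sense on a null event, but both sides are
    0.\<close>
  case True
  note [measurable] = sets_history_imp_event[OF A]
  have "{\<omega> \<in> A. X k \<omega> = s} \<in> null_sets M"
    using True by (intro null_setsI) (simp_all add: emeasure_eq_measure)
  then show ?thesis
    using True by (simp add: nn_integral_null_set emeasure_eq_measure)
next
  case False
  define D where "D \<omega> = T (Suc k) \<omega> - T k \<omega>" for \<omega>
  \<comment> \<open>\<open>B\<close> is kept as a function because the law of \<open>D\<close> is
    compared for two past events, \<open>A\<close> and \<open>space M\<close>; the latter gives
    exactly \<open>given_state M X k s\<close>.\<close>
  define B where "B A = {\<omega> \<in> A. X k \<omega> = s}" for A
  have [measurable]: "D \<in> borel_measurable M"
    unfolding D_def by measurable
  have B_event [measurable]: "B A \<in> events" if "A \<in> sets (history M X T k)" for A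
    using sets_history_imp_event[OF that] unfolding B_def by measurable
  have real_dist: "real_distribution (distr (uniform_measure M (B A)) borel D)"
    if "A \<in> sets (history M X T k)" "prob (B A) \<noteq> 0" for A
    using that
    by (intro real_distribution.intro prob_space.prob_space_distr prob_space_uniform_measure
        real_distribution_axioms.intro) (auto simp: emeasure_eq_measure)
  have cdf: "cdf (distr (uniform_measure M (B A)) borel D) t = (\<Sum>j\<in>UNIV. Q s j t)"
    if hA: "A \<in> sets (history M X T k)" and pos: "prob (B A) \<noteq> 0" for A t
  proof -
    note [measurable] = sets_history_imp_event[OF hA] B_event[OF hA]
    have "cdf (distr (uniform_measure M (B A)) borel D) t
        = measure (uniform_measure M (B A)) {\<omega> \<in> space M. D \<omega> \<le> t}"
      by (simp add: cdf_def measure_distr vimage_def Int_def conj_commute)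
    also have "\<dots> = prob (B A \<inter> {\<omega> \<in> space M. D \<omega> \<le> t}) / prob (B A)"
      using pos by (subst measure_uniform_measure) (auto simp: emeasure_eq_measure)
    also have "B A \<inter> {\<omega> \<in> space M. D \<omega> \<le> t}
        = (\<Union>j. {\<omega> \<in> A. X k \<omega> = s \<and> X (Suc k) \<omega> = j \<and> D \<omega> \<le> t})"
      using sets.sets_into_space[OF sets_history_imp_event[OF hA]] by (auto simp: B_def)
    also have "prob \<dots> = (\<Sum>j\<in>UNIV. prob {\<omega> \<in> A. X k \<omega> = s \<and> X (Suc k) \<omega> = j \<and> D \<omega> \<le> t})"
      by (intro finite_measure_finite_Union) (auto simp: disjoint_family_on_def)
    also have "\<dots> = (\<Sum>j\<in>UNIV. Q s j t) * prob (B A)"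
      by (simp add: D_def prob_kernel[OF hA] B_def sum_distrib_right)
    finally show ?thesis
      using pos by simp
  qed
  have mean: "(\<integral>\<^sup>+x. ennreal x \<partial>distr (uniform_measure M (B A)) borel D)
      = (\<integral>\<^sup>+\<omega>. ennreal (D \<omega>) * indicator (B A) \<omega> \<partial>M) / emeasure M (B A)"
    if "A \<in> sets (history M X T k)" for A
    using B_event[OF that] by (simp add: nn_integral_distr nn_integral_uniform_measure)
  have top: "space M \<in> sets (history M X T k)"
    using sets.top[of "history M X T k"] by simp
  have pos: "prob (B A) > 0"
    using False by (simp add: B_def zero_less_measure_iff)
  have "A \<subseteq> space M"
    using sets_history_imp_event[OF A] by (rule sets.sets_into_space)
  then have "prob (B A) \<le> prob (B (space M))"
    using B_event[OF top] by (intro finite_measure_mono) (auto simp: B_def)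
  with pos have pos': "prob (B (space M)) > 0"
    by linarith
  have same: "distr (uniform_measure M (B A)) borel D = distr (uniform_measure M (B (space M))) borel D"
    using A top pos pos' by (intro cdf_unique real_dist) (auto simp: cdf)
  have "has_bochner_integral (uniform_measure M (B (space M))) D (\<mu> s)"
    using \<mu> pos' unfolding has_mean_holding_times_def given_state_def B_def D_def by blast
  \<comment> \<open>Since \<open>ennreal\<close> sends negative values to 0, almost sure
    nonnegativity is what identifies the nonnegative integral with the mean.\<close>
  moreover have "AE \<omega> in uniform_measure M (B (space M)). 0 \<le> D \<omega>"
    using T_increasing[of k] B_event[OF top]
    by (intro AE_uniform_measureI) (auto simp: D_def elim: eventually_mono)
  ultimately have "(\<integral>\<^sup>+\<omega>. ennreal (D \<omega>) \<partial>uniform_measure M (B (space M))) = ennreal (\<mu> s)"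
    by (simp add: has_bochner_integral_iff nn_integral_eq_integral)
  then have "(\<integral>\<^sup>+x. ennreal x \<partial>distr (uniform_measure M (B (space M))) borel D) = ennreal (\<mu> s)"
    by (simp add: nn_integral_distr)
  then have "(\<integral>\<^sup>+\<omega>. ennreal (D \<omega>) * indicator (B A) \<omega> \<partial>M) / emeasure M (B A) = ennreal (\<mu> s)"
    using mean[OF A] same by simp
  moreover have "emeasure M (B A) \<noteq> 0" "emeasure M (B A) \<noteq> \<top>"
    using pos by (auto simp: emeasure_eq_measure)
  ultimately have "(\<integral>\<^sup>+\<omega>. ennreal (D \<omega>) * indicator (B A) \<omega> \<partial>M) = ennreal (\<mu> s) * emeasure M (B A)"
    by (metis ennreal_divide_times ennreal_times_divide ennreal_mult_divide_eq mult.commute)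
  then show ?thesis
    by (simp add: D_def B_def)
qed

text \<open>Holding times are nonnegative almost surely. The value \<open>\<mu> s\<close> is tied to
  them only at steps where \<open>s\<close> has positive probability.\<close>

lemma mean_holding_time_nonneg:
  assumes \<mu>: "has_mean_holding_times M X T \<mu>"
    and "prob {\<omega> \<in> space M. X k \<omega> = s} > 0"
  shows "\<mu> s \<ge> 0"
proof -
  let ?N = "given_state M X k s"
  have "has_bochner_integral ?N (\<lambda>\<omega>. T (Suc k) \<omega> - T k \<omega>) (\<mu> s)"
    using assms unfolding has_mean_holding_times_def by blast
  moreover have "AE \<omega> in ?N. 0 \<le> T (Suc k) \<omega> - T k \<omega>"
    unfolding given_state_def using T_increasing[of k]
    by (intro AE_uniform_measureI) (auto elim: eventually_mono)
  ultimately show ?thesis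
    by (metis has_bochner_integral_iff integral_nonneg_AE)
qed

section \<open>Survival before the first passage\<close>

definition taboo_event :: "'s \<Rightarrow> 's \<Rightarrow> nat \<Rightarrow> 'w set" where
  "taboo_event i j k = {\<omega> \<in> space M. X 0 \<omega> = i \<and> (\<forall>l\<in>{1..k}. X l \<omega> \<noteq> j)}"

text \<open>This is the quantity written a_k(s) in the outline. The taboo begins at step 1, so a
  start in \<open>j\<close> is allowed and recurrence times are covered too. Division by the
  probability of \<open>X 0 = i\<close> is deferred to the very end.\<close>

definition taboo_prob :: "'s \<Rightarrow> 's \<Rightarrow> nat \<Rightarrow> 's \<Rightarrow> real" where
  "taboo_prob i j k s = prob {\<omega> \<in> taboo_event i j k. X k \<omega> = s}"

text \<open>Survival up to step \<open>k\<close> depends on the states up to step \<open>k\<close>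
  only, so the one-step laws given the past apply to it.\<close>

lemma taboo_event_in_history: "taboo_event i j k \<in> sets (history M X T k)"
proof -
  have "taboo_event i j k = {\<omega> \<in> space M. X 0 \<omega> = i} \<inter>
      (space (history M X T k) - (\<Union>l\<in>{1..k}. {\<omega> \<in> space M. X l \<omega> = j}))"
    by (auto simp: taboo_event_def)
  also have "\<dots> \<in> sets (history M X T k)"
    by (intro sets.Int sets.Diff sets.top sets.finite_UN state_in_history) auto
  finally show ?thesis .
qed

lemma taboo_event_event [measurable]: "taboo_event i j k \<in> events"
  using taboo_event_in_history by (rule sets_history_imp_event)

lemma taboo_prob_nonneg: "0 \<le> taboo_prob i j k s"
  by (simp add: taboo_prob_def)

lemma sum_taboo_prob: "(\<Sum>s\<in>UNIV. taboo_prob i j k s) = prob (taboo_event i j k)"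
proof -
  have "prob (\<Union>s. {\<omega> \<in> taboo_event i j k. X k \<omega> = s}) = (\<Sum>s\<in>UNIV. taboo_prob i j k s)"
    unfolding taboo_prob_def
    by (intro finite_measure_finite_Union) (auto simp: disjoint_family_on_def)
  moreover have "(\<Union>s. {\<omega> \<in> taboo_event i j k. X k \<omega> = s}) = taboo_event i j k"
    by auto
  ultimately show ?thesis
    by simp
qed

lemma taboo_prob_0:
  "taboo_prob i j 0 s = (if s = i then prob {\<omega> \<in> space M. X 0 \<omega> = i} else 0)"
  by (auto simp: taboo_prob_def taboo_event_def intro!: arg_cong[where f = prob] cong: conj_cong)

lemma measurable_first_passage_time [measurable]:
  "first_passage_time X T j \<in> borel_measurable M"
proof -
  have [measurable]: "(\<lambda>\<omega>. LEAST k. k \<ge> 1 \<and> X k \<omega> = j) \<in> measurable M (count_space UNIV)"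
    by measurable
  have "(\<lambda>\<omega>. T (LEAST k. k \<ge> 1 \<and> X k \<omega> = j) \<omega>) \<in> borel_measurable M"
    by (rule measurable_compose_countable[of T]) measurable
  then show ?thesis
    unfolding first_passage_time_def [abs_def] by measurable
qed

text \<open>The first passage time is the telescoping sum of the holding times that precede it.
  Passage must occur: a path from \<open>i\<close> that never enters \<open>j\<close> has an
  infinite left side, while its series may converge.\<close>

lemma first_passage_time_eq_suminf:
  assumes "\<omega> \<in> space M" and "T 0 \<omega> = 0"
    and mono: "\<And>k. T k \<omega> \<le> T (Suc k) \<omega>"
    and passage: "\<exists>k. \<omega> \<notin> taboo_event i j k"
  shows "first_passage_time X T j \<omega> * indicator {\<omega> \<in> space M. X 0 \<omega> = i} \<omega>
    = (\<Sum>k. ennreal (T (Suc k) \<omega> - T k \<omega>) * indicator (taboo_event i j k) \<omega>)"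
proof (cases "X 0 \<omega> = i")
  case False
  then show ?thesis
    by (simp add: taboo_event_def)
next
  case True
  define N where "N = (LEAST k. k \<ge> 1 \<and> X k \<omega> = j)"
  have ex: "\<exists>k\<ge>1. X k \<omega> = j"
    using passage True assms(1) by (auto simp: taboo_event_def)
  then have N: "N \<ge> 1 \<and> X N \<omega> = j"
    unfolding N_def by (metis (mono_tags, lifting) LeastI_ex)
  have N_le: "N \<le> k" if "k \<ge> 1" "X k \<omega> = j" for k
    unfolding N_def using that by (intro Least_le) simp
  \<comment> \<open>Hence the indicators cut the series off after exactly \<open>N\<close>
    terms.\<close>
  have taboo: "\<omega> \<in> taboo_event i j k \<longleftrightarrow> k < N" for k
  proof
    assume "\<omega> \<in> taboo_event i j k"
    then show "k < N"
      using N by (force simp: taboo_event_def not_less)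
  next
    assume "k < N"
    then show "\<omega> \<in> taboo_event i j k"
      using N_le True assms(1) by (fastforce simp: taboo_event_def)
  qed
  have "(\<Sum>k. ennreal (T (Suc k) \<omega> - T k \<omega>) * indicator (taboo_event i j k) \<omega>)
      = (\<Sum>k<N. ennreal (T (Suc k) \<omega> - T k \<omega>) * indicator (taboo_event i j k) \<omega>)"
    by (intro suminf_finite) (auto simp: taboo)
  also have "\<dots> = (\<Sum>k<N. ennreal (T (Suc k) \<omega> - T k \<omega>))"
    by (intro sum.cong) (auto simp: taboo)
  also have "\<dots> = ennreal (\<Sum>k<N. T (Suc k) \<omega> - T k \<omega>)"
    using mono by (intro sum_ennreal) simp
  also have "(\<Sum>k<N. T (Suc k) \<omega> - T k \<omega>) = T N \<omega>"
    using sum_lessThan_telescope[of "\<lambda>k. T k \<omega>" N] assms(2) by simp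
  finally show ?thesis
    using ex True assms(1) by (simp add: first_passage_time_def N_def)
qed

section \<open>Taboo recursion and mean first passage times\<close>

context
  fixes P :: "real^'s^'s"
  assumes Q_tendsto: "\<And>i j. (Q i j \<longlongrightarrow> P$i$j) at_top"
begin

lemma taboo_prob_Suc:
  "taboo_prob i j (Suc k) r = (if r = j then 0 else \<Sum>s\<in>UNIV. P$s$r * taboo_prob i j k s)"
proof (cases "r = j")
  case True
  then have "{\<omega> \<in> taboo_event i j (Suc k). X (Suc k) \<omega> = r} = {}"
    by (auto simp: taboo_event_def)
  with True show ?thesis
    by (simp only: taboo_prob_def measure_empty simp_thms if_True)
next
  case False
  then have "{\<omega> \<in> taboo_event i j (Suc k). X (Suc k) \<omega> = r}
      = (\<Union>s. {\<omega> \<in> taboo_event i j k. X k \<omega> = s \<and> X (Suc k) \<omega> = r})"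
    by (auto simp: taboo_event_def atLeastAtMostSuc_conv)
  moreover have "prob \<dots> = (\<Sum>s\<in>UNIV. prob {\<omega> \<in> taboo_event i j k. X k \<omega> = s \<and> X (Suc k) \<omega> = r})"
    by (intro finite_measure_finite_Union) (auto simp: disjoint_family_on_def)
  ultimately show ?thesis
    using False
    by (simp add: taboo_prob_def prob_transition[OF taboo_event_in_history Q_tendsto])
qed

text \<open>Exchanging the two sums moves \<open>P\<close> from \<open>m\<close> to the taboo
  probabilities. The index \<open>j\<close> missing from the system for \<open>m\<close> matches the
  zero of \<open>taboo_prob\<close> at \<open>j\<close> after one step. The right-hand side
  \<open>\<nu>\<close> is general because both \<open>\<mu>\<close> and the constant 1 will be
  inserted.\<close>

lemma sum_taboo_prob_telescope:
  assumes "\<And>s. m s = \<nu> s + (\<Sum>r\<in>-{j}. P$s$r * m r)"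
  shows "(\<Sum>s\<in>UNIV. \<nu> s * taboo_prob i j k s)
    = (\<Sum>s\<in>UNIV. m s * taboo_prob i j k s) - (\<Sum>s\<in>UNIV. m s * taboo_prob i j (Suc k) s)"
proof -
  have "(\<Sum>r\<in>UNIV. m r * taboo_prob i j (Suc k) r)
      = (\<Sum>r\<in>-{j}. m r * (\<Sum>s\<in>UNIV. P$s$r * taboo_prob i j k s))"
    by (intro sum.mono_neutral_cong_right) (auto simp: taboo_prob_Suc)
  also have "\<dots> = (\<Sum>s\<in>UNIV. (\<Sum>r\<in>-{j}. P$s$r * m r) * taboo_prob i j k s)"
    unfolding sum_distrib_left sum_distrib_right
    by (subst sum.swap) (simp add: mult_ac)
  also have "\<dots> = (\<Sum>s\<in>UNIV. (m s - \<nu> s) * taboo_prob i j k s)"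
  proof -
    have "(\<Sum>r\<in>-{j}. P$s$r * m r) = m s - \<nu> s" for s
      using assms[of s] by linarith
    then show ?thesis
      by simp
  qed
  finally show ?thesis
    by (simp add: left_diff_distrib sum_subtractf)
qed

text \<open>With unit holding times the telescoped sums bound the partial sums of the survival
  probabilities by their initial value; a summable sequence tends to 0.\<close>

lemma taboo_event_tendsto_0:
  assumes "\<And>s. n s = 1 + (\<Sum>r\<in>-{j}. P$s$r * n r)" and nonneg: "\<And>s. n s \<ge> 0"
  shows "(\<lambda>k. prob (taboo_event i j k)) \<longlonglongrightarrow> 0"
proof -
  let ?S = "\<lambda>k. \<Sum>s\<in>UNIV. n s * taboo_prob i j k s"
  have step: "prob (taboo_event i j k) = ?S k - ?S (Suc k)" for k
    using sum_taboo_prob_telescope[where \<nu> = "\<lambda>_. 1", OF assms(1), of i k] by (simp add: sum_taboo_prob)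
  have "(\<Sum>k<N. prob (taboo_event i j k)) \<le> ?S 0" for N
  proof -
    have "(\<Sum>k<N. prob (taboo_event i j k)) = ?S 0 - ?S N"
      unfolding step by (rule sum_lessThan_telescope')
    moreover have "?S N \<ge> 0"
      by (intro sum_nonneg mult_nonneg_nonneg nonneg taboo_prob_nonneg)
    ultimately show ?thesis
      by simp
  qed
  then have "summable (\<lambda>k. prob (taboo_event i j k))"
    by (intro summableI_nonneg_bounded) auto
  then show ?thesis
    by (rule summable_LIMSEQ_zero)
qed

lemma mean_first_passage_time_eqI:
  assumes \<mu>: "has_mean_holding_times M X T \<mu>" and \<mu>_nonneg: "\<And>s. \<mu> s \<ge> 0"
    and m: "\<And>s. m s = \<mu> s + (\<Sum>r\<in>-{j}. P$s$r * m r)"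
    and n: "\<And>s. n s = 1 + (\<Sum>r\<in>-{j}. P$s$r * n r)" "\<And>s. n s \<ge> 0"
    and pos: "prob {\<omega> \<in> space M. X 0 \<omega> = i} > 0"
  shows "mean_first_passage_time M X T i j = ennreal (m i)"
proof -
  let ?A = "taboo_event i j" and ?p = "prob {\<omega> \<in> space M. X 0 \<omega> = i}"
  note lim = taboo_event_tendsto_0[OF n, of i]
  \<comment> \<open>The intersection is the event that the chain starts in \<open>i\<close> and
    never enters \<open>j\<close>; it is null.\<close>
  have "prob (\<Inter>k. ?A k) \<le> prob (?A k)" for k
    by (intro finite_measure_mono) auto
  then have "prob (\<Inter>k. ?A k) \<le> 0"
    by (intro LIMSEQ_le_const[OF lim]) auto
  then have "(\<Inter>k. ?A k) \<in> null_sets M"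
    by (intro null_setsI) (auto simp: emeasure_eq_measure measure_le_0_iff)
  then have passage: "AE \<omega> in M. \<exists>k. \<omega> \<notin> ?A k"
    using AE_not_in by fastforce
  have "AE \<omega> in M. \<forall>k. T k \<omega> \<le> T (Suc k) \<omega>"
    using T_increasing by (simp add: AE_all_countable)
  then have ae: "AE \<omega> in M. first_passage_time X T j \<omega> * indicator {\<omega> \<in> space M. X 0 \<omega> = i} \<omega>
      = (\<Sum>k. ennreal (T (Suc k) \<omega> - T k \<omega>) * indicator (?A k) \<omega>)"
    using T_0 passage AE_space by eventually_elim (rule first_passage_time_eq_suminf; blast)

  \<comment> \<open>Each taboo probability is dominated by the total survival probability; with
    finitely many states, the telescoping remainder therefore vanishes.\<close>
  have tp_lim: "(\<lambda>k. taboo_prob i j k s) \<longlonglongrightarrow> 0" for s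
  proof (rule tendsto_sandwich[OF _ _ tendsto_const lim])
    show "\<forall>\<^sub>F k in sequentially. taboo_prob i j k s \<le> prob (?A k)"
      unfolding sum_taboo_prob[symmetric]
      by (intro always_eventually allI member_le_sum) (auto simp: taboo_prob_nonneg)
  qed (simp add: taboo_prob_nonneg)
  then have "(\<lambda>k. \<Sum>s\<in>UNIV. m s * taboo_prob i j k s) \<longlonglongrightarrow> 0"
    by (intro tendsto_null_sum tendsto_mult_right_zero)
  then have "(\<lambda>k. \<Sum>s\<in>UNIV. \<mu> s * taboo_prob i j k s)
      sums ((\<Sum>s\<in>UNIV. m s * taboo_prob i j 0 s) - 0)"
    unfolding sum_taboo_prob_telescope[OF m] by (rule telescope_sums')
  also have "(\<Sum>s\<in>UNIV. m s * taboo_prob i j 0 s) - 0 = m i * ?p"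
    by (simp add: taboo_prob_0 if_distrib cong: if_cong)
  finally have sums: "(\<lambda>k. \<Sum>s\<in>UNIV. \<mu> s * taboo_prob i j k s) sums (m i * ?p)" .

  have step: "(\<integral>\<^sup>+\<omega>. ennreal (T (Suc k) \<omega> - T k \<omega>) * indicator (?A k) \<omega> \<partial>M)
      = ennreal (\<Sum>s\<in>UNIV. \<mu> s * taboo_prob i j k s)" for k
  proof -
    \<comment> \<open>Splitting by the current state makes the mean of the next holding time a known
      constant on each piece.\<close>
    have "indicator (?A k) \<omega> = (\<Sum>s\<in>UNIV. indicator {\<omega> \<in> ?A k. X k \<omega> = s} \<omega> :: ennreal)" for \<omega>
      by (cases "\<omega> \<in> ?A k") (simp_all add: indicator_def)
    then have "(\<integral>\<^sup>+\<omega>. ennreal (T (Suc k) \<omega> - T k \<omega>) * indicator (?A k) \<omega> \<partial>M)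
        = (\<integral>\<^sup>+\<omega>. (\<Sum>s\<in>UNIV. ennreal (T (Suc k) \<omega> - T k \<omega>) *
            indicator {\<omega> \<in> ?A k. X k \<omega> = s} \<omega>) \<partial>M)"
      by (simp add: sum_distrib_left)
    also have "\<dots> = (\<Sum>s\<in>UNIV. ennreal (\<mu> s) * emeasure M {\<omega> \<in> ?A k. X k \<omega> = s})"
      by (subst nn_integral_sum) (measurable, simp only: nn_integral_holding_time[OF taboo_event_in_history \<mu>])
    also have "\<dots> = (\<Sum>s\<in>UNIV. ennreal (\<mu> s * taboo_prob i j k s))"
      using \<mu>_nonneg by (simp add: emeasure_eq_measure taboo_prob_def ennreal_mult)
    also have "\<dots> = ennreal (\<Sum>s\<in>UNIV. \<mu> s * taboo_prob i j k s)"
      by (intro sum_ennreal mult_nonneg_nonneg \<mu>_nonneg taboo_prob_nonneg)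
    finally show ?thesis .
  qed

  have "(\<integral>\<^sup>+\<omega>. first_passage_time X T j \<omega> * indicator {\<omega> \<in> space M. X 0 \<omega> = i} \<omega> \<partial>M)
      = (\<Sum>k. \<integral>\<^sup>+\<omega>. ennreal (T (Suc k) \<omega> - T k \<omega>) * indicator (?A k) \<omega> \<partial>M)"
    unfolding nn_integral_cong_AE[OF ae] by (intro nn_integral_suminf) measurable
  also have "\<dots> = ennreal (m i * ?p)"
    unfolding step
    by (intro suminf_ennreal_eq sums sum_nonneg mult_nonneg_nonneg \<mu>_nonneg taboo_prob_nonneg)
  \<comment> \<open>Dividing by the probability of the initial state turns the restricted integral
    into the conditional mean.\<close>
  finally have "mean_first_passage_time M X T i j = ennreal (m i * ?p) / ennreal ?p"
    unfolding mean_first_passage_time_def given_state_def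
    by (subst nn_integral_uniform_measure) (auto simp: emeasure_eq_measure)
  then show ?thesis
    using pos by (simp add: ennreal_mult'' ennreal_mult_divide_eq)
qed

section \<open>Visited states and stochastic rows\<close>

lemma irreducible_imp_state_visited:
  assumes "irreducible_matrix P"
  shows "\<exists>k. prob {\<omega> \<in> space M. X k \<omega> = s} > 0"
proof -
  let ?p = "\<lambda>k s. prob {\<omega> \<in> space M. X k \<omega> = s}"
  \<comment> \<open>The initial distribution may miss some states, so visits at any step count. A
    state of \<open>C\<close> passes mass on wherever its row is nonzero, hence \<open>C\<close> is
    closed.\<close>
  define C where "C = {s. \<exists>k. ?p k s > 0}"
  have "(\<Sum>s\<in>UNIV. ?p 0 s) = prob (\<Union>s. {\<omega> \<in> space M. X 0 \<omega> = s})"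
    by (rule finite_measure_finite_Union[symmetric]) (auto simp: disjoint_family_on_def)
  also have "(\<Union>s. {\<omega> \<in> space M. X 0 \<omega> = s}) = space M"
    by auto
  finally have sum: "(\<Sum>s\<in>UNIV. ?p 0 s) = 1"
    by (simp add: prob_space)
  have "\<exists>i. ?p 0 i \<noteq> 0"
  proof (rule ccontr)
    assume "\<not> ?thesis"
    then have "(\<Sum>s\<in>UNIV. ?p 0 s) = 0"
      by simp
    with sum show False
      by simp
  qed
  then obtain i where "?p 0 i \<noteq> 0"
    by blast
  then have "i \<in> C"
    unfolding C_def by (auto simp: zero_less_measure_iff)
  moreover have "P$r$s = 0" if "r \<in> C" "s \<notin> C" for r s
  proof -
    obtain k where k: "?p k r > 0"
      using \<open>r \<in> C\<close> by (auto simp: C_def)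
    have eq: "P$r$s * ?p k r = prob {\<omega> \<in> space M. X k \<omega> = r \<and> X (Suc k) \<omega> = s}"
      using prob_transition[OF sets.top Q_tendsto, of k r s] by simp
    also have "\<dots> \<le> ?p (Suc k) s"
      by (intro finite_measure_mono) auto
    also have "\<dots> = 0"
      using \<open>s \<notin> C\<close> by (auto simp: C_def zero_less_measure_iff)
    finally have "P$r$s * ?p k r \<le> 0" .
    \<comment> \<open>The sign of the entry is still unknown here; it is the probability in
      \<open>eq\<close> that bounds the product from below.\<close>
    moreover have "P$r$s * ?p k r \<ge> 0"
      unfolding eq by simp
    ultimately show ?thesis
      using k by (metis antisym less_irrefl mult_eq_0_iff)
  qed
  ultimately have "C = UNIV"
    by (rule irreducible_matrix_closed_set[OF assms])
  then show ?thesis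
    by (auto simp: C_def)
qed

text \<open>Multiplied by the probability of the visit, the row consists of the joint probabilities
  with the next state, which add up to that same probability.\<close>

lemma visited_imp_stochastic:
  assumes "prob {\<omega> \<in> space M. X k \<omega> = s} > 0"
  shows "P$s$j \<ge> 0" and "(\<Sum>j\<in>UNIV. P$s$j) = 1"
proof -
  let ?p = "prob {\<omega> \<in> space M. X k \<omega> = s}"
  have eq: "P$s$j * ?p = prob {\<omega> \<in> space M. X k \<omega> = s \<and> X (Suc k) \<omega> = j}" for j
    using prob_transition[OF sets.top Q_tendsto, of k s j] by simp
  then have "P$s$j * ?p \<ge> 0"
    by simp
  then show "P$s$j \<ge> 0"
    using assms by (simp add: zero_le_mult_iff)
  have "(\<Sum>j\<in>UNIV. P$s$j) * ?p = (\<Sum>j\<in>UNIV. prob {\<omega> \<in> space M. X k \<omega> = s \<and> X (Suc k) \<omega> = j})"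
    by (simp add: sum_distrib_right eq)
  also have "\<dots> = prob (\<Union>j. {\<omega> \<in> space M. X k \<omega> = s \<and> X (Suc k) \<omega> = j})"
    by (rule finite_measure_finite_Union[symmetric]) (auto simp: disjoint_family_on_def)
  also have "(\<Union>j. {\<omega> \<in> space M. X k \<omega> = s \<and> X (Suc k) \<omega> = j}) = {\<omega> \<in> space M. X k \<omega> = s}"
    by auto
  finally show "(\<Sum>j\<in>UNIV. P$s$j) = 1"
    using assms by simp
qed

end

end

section \<open>Three states\<close>

text \<open>The entry at \<open>j\<close> is the total weight of the spanning trees directed towards the root \<open>j\<close>.\<close>

definition tree_weights :: "real^3^3 \<Rightarrow> real^3" where
  "tree_weights P = vector
     [P$2$1 * P$3$1 + P$2$1 * P$3$2 + P$2$3 * P$3$1,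
      P$1$2 * P$3$1 + P$1$2 * P$3$2 + P$1$3 * P$3$2,
      P$1$3 * P$2$1 + P$1$2 * P$2$3 + P$1$3 * P$2$3]"

text \<open>The holding times are a parameter: \<open>\<mu>\<close> yields the claimed matrix, the
  constant 1 the mean numbers of steps.\<close>

definition passage_matrix :: "real^3^3 \<Rightarrow> (3 \<Rightarrow> real) \<Rightarrow> real^3^3" where
  "passage_matrix P \<nu> =
     (let \<Delta> = tree_weights P; S = \<Delta>$1 * \<nu> 1 + \<Delta>$2 * \<nu> 2 + \<Delta>$3 * \<nu> 3
      in vector
        [vector [S / \<Delta>$1,
                 ((P$3$1 + P$3$2) * \<nu> 1 + P$1$3 * \<nu> 3) / \<Delta>$2,
                 ((P$2$1 + P$2$3) * \<nu> 1 + P$1$2 * \<nu> 2) / \<Delta>$3],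
         vector [((P$3$1 + P$3$2) * \<nu> 2 + P$2$3 * \<nu> 3) / \<Delta>$1,
                 S / \<Delta>$2,
                 (P$2$1 * \<nu> 1 + (P$1$2 + P$1$3) * \<nu> 2) / \<Delta>$3],
         vector [(P$3$2 * \<nu> 2 + (P$2$1 + P$2$3) * \<nu> 3) / \<Delta>$1,
                 (P$3$1 * \<nu> 1 + (P$1$2 + P$1$3) * \<nu> 3) / \<Delta>$2,
                 S / \<Delta>$3]])"

lemma Compl_singleton_3: "- {1::3} = {2, 3}" "- {2::3} = {1, 3}" "- {3::3} = {1, 2}"
  using exhaust_3 by auto

text \<open>A root has positive weight as soon as both other states can be left and the root can be
  entered; irreducibility gives all three.\<close>

lemma tree_weights_pos:
  fixes P :: "real^3^3"
  assumes irr: "irreducible_matrix P" and nonneg: "\<And>r s. P$r$s \<ge> 0"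
  shows "tree_weights P $ j > 0"
proof -
  \<comment> \<open>Otherwise the singleton \<open>{r}\<close> would be closed.\<close>
  have leave: "P$r$s > 0 \<or> P$r$t > 0" if "- {r} = {s, t}" for r s t
  proof (rule ccontr)
    assume "\<not> ?thesis"
    then have zero: "P$r$s = 0" "P$r$t = 0"
      using nonneg[of r s] nonneg[of r t] by (simp_all add: not_less)
    have "P$r$u = 0" if "u \<notin> {r}" for u
    proof -
      have "u \<in> {s, t}"
        using that unfolding \<open>- {r} = {s, t}\<close>[symmetric] by simp
      then show ?thesis
        using zero by (elim insertE emptyE) simp_all
    qed
    then have "{r} = UNIV"
      by (intro irreducible_matrix_closed_set[OF irr, of r]) (simp_all only: singleton_iff)
    with that show False
      by (metis Compl_UNIV_eq insert_not_empty)
  qed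
  \<comment> \<open>Otherwise the pair \<open>{s, t}\<close> would be closed.\<close>
  have enter: "P$s$r > 0 \<or> P$t$r > 0" if "- {r} = {s, t}" for r s t
  proof (rule ccontr)
    assume "\<not> ?thesis"
    then have zero: "P$s$r = 0" "P$t$r = 0"
      using nonneg[of s r] nonneg[of t r] by (simp_all add: not_less)
    have "P$u$v = 0" if u: "u \<in> {s, t}" and v: "v \<notin> {s, t}" for u v
    proof -
      have "v = r"
        using v unfolding \<open>- {r} = {s, t}\<close>[symmetric] by simp
      with u show ?thesis
        using zero by (elim insertE emptyE) simp_all
    qed
    then have "{s, t} = UNIV"
      by (rule irreducible_matrix_closed_set[OF irr insertI1])
    with that show False
      by (metis Compl_UNIV_eq double_complement insert_not_empty)
  qed
  note * = leave[OF Compl_singleton_3(1)] leave[OF Compl_singleton_3(2)] leave[OF Compl_singleton_3(3)]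
    enter[OF Compl_singleton_3(1)] enter[OF Compl_singleton_3(2)] enter[OF Compl_singleton_3(3)]
  \<comment> \<open>Common shape of the three weights. If \<open>a\<close> vanishes, the
    disjunctions force \<open>d\<close> and \<open>e\<close> to be positive.\<close>
  have pos: "a * b + a * c + d * e > 0"
    if "a > 0 \<or> d > 0" "b > 0 \<or> c > 0" "a > 0 \<or> e > 0" "a \<ge> 0" "b \<ge> 0" "c \<ge> 0" "d \<ge> 0" "e \<ge> 0"
    for a b c d e :: real
  proof (cases "a > 0")
    case True
    then have "a * (b + c) > 0"
      using that by (intro mult_pos_pos) auto
    moreover have "d * e \<ge> 0"
      using that by simp
    ultimately show ?thesis
      by (simp add: distrib_left)
  next
    case False
    with that show ?thesis
      by auto
  qed
  have "tree_weights P $ 1 > 0"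
    using pos[of "P$2$1" "P$2$3" "P$3$1" "P$3$2" "P$3$1"] * nonneg
    by (simp add: tree_weights_def)
  moreover have "tree_weights P $ 2 > 0"
    using pos[of "P$1$2" "P$1$3" "P$3$1" "P$3$2" "P$3$2"] * nonneg
    by (simp add: tree_weights_def)
  moreover have "tree_weights P $ 3 > 0"
    using pos[of "P$1$3" "P$1$2" "P$2$1" "P$2$3" "P$2$3"] * nonneg
    by (auto simp: tree_weights_def add_ac)
  ultimately show ?thesis
    using exhaust_3[of j] by auto
qed

text \<open>Once the row sums eliminate the diagonal of \<open>P\<close> and the denominators are
  cleared, each of the nine equations is a polynomial identity.\<close>

lemma passage_matrix_solves:
  fixes P :: "real^3^3"
  assumes stoch: "\<And>r. (\<Sum>s\<in>UNIV. P$r$s) = 1" and nz: "\<And>j. tree_weights P $ j \<noteq> 0"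
  shows "passage_matrix P \<nu> $ s $ j = \<nu> s + (\<Sum>r\<in>-{j}. P$s$r * passage_matrix P \<nu> $ r $ j)"
proof -
  have diag: "P$1$1 = 1 - P$1$2 - P$1$3" "P$2$2 = 1 - P$2$1 - P$2$3" "P$3$3 = 1 - P$3$1 - P$3$2"
    using stoch[of 1] stoch[of 2] stoch[of 3] by (simp_all add: sum_3)
  have "\<forall>s j. passage_matrix P \<nu> $ s $ j
      = \<nu> s + (\<Sum>r\<in>-{j}. P$s$r * passage_matrix P \<nu> $ r $ j)"
    unfolding forall_3 Compl_singleton_3
    using nz[of 1] nz[of 2] nz[of 3]
    by (simp add: passage_matrix_def Let_def diag tree_weights_def divide_simps) (simp add: algebra_simps)
  then show ?thesis
    by blast
qed

lemma passage_matrix_nonneg: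
  assumes "\<And>r s. P$r$s \<ge> 0" and "\<And>j. tree_weights P $ j > 0" and "\<And>s. \<nu> s \<ge> 0"
  shows "passage_matrix P \<nu> $ s $ j \<ge> 0"
proof -
  have "\<forall>s j. passage_matrix P \<nu> $ s $ j \<ge> 0"
    unfolding forall_3 passage_matrix_def Let_def vector_3
    using assms by (simp add: less_imp_le)
  then show ?thesis
    by blast
qed

theorem mainTheorem8:
  fixes M :: "'w measure"
    and X :: "nat \<Rightarrow> 'w \<Rightarrow> 3"
    and T :: "nat \<Rightarrow> 'w \<Rightarrow> real"
    and Q :: "3 \<Rightarrow> 3 \<Rightarrow> real \<Rightarrow> real"
    and P :: "real^3^3"
    and \<mu> :: "3 \<Rightarrow> real"
    and \<Delta>\<^sub>1 \<Delta>\<^sub>2 \<Delta>\<^sub>3 :: real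
    and M\<^sub>3 :: "real^3^3"
  assumes "markov_renewal_process M X T Q"
    and "\<And>i j. (Q i j \<longlongrightarrow> P$i$j) at_top"
    and "irreducible_matrix P"
    and "has_mean_holding_times M X T \<mu>"
    and "\<Delta>\<^sub>1 = P$2$1 * P$3$1 + P$2$1 * P$3$2 + P$2$3 * P$3$1"
    and "\<Delta>\<^sub>2 = P$1$2 * P$3$1 + P$1$2 * P$3$2 + P$1$3 * P$3$2"
    and "\<Delta>\<^sub>3 = P$1$3 * P$2$1 + P$1$2 * P$2$3 + P$1$3 * P$2$3"
    and "M\<^sub>3 = vector
      [vector [(\<Delta>\<^sub>1 * \<mu> 1 + \<Delta>\<^sub>2 * \<mu> 2 + \<Delta>\<^sub>3 * \<mu> 3) / \<Delta>\<^sub>1,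
               ((P$3$1 + P$3$2) * \<mu> 1 + P$1$3 * \<mu> 3) / \<Delta>\<^sub>2,
               ((P$2$1 + P$2$3) * \<mu> 1 + P$1$2 * \<mu> 2) / \<Delta>\<^sub>3],
       vector [((P$3$1 + P$3$2) * \<mu> 2 + P$2$3 * \<mu> 3) / \<Delta>\<^sub>1,
               (\<Delta>\<^sub>1 * \<mu> 1 + \<Delta>\<^sub>2 * \<mu> 2 + \<Delta>\<^sub>3 * \<mu> 3) / \<Delta>\<^sub>2,
               (P$2$1 * \<mu> 1 + (P$1$2 + P$1$3) * \<mu> 2) / \<Delta>\<^sub>3],
       vector [(P$3$2 * \<mu> 2 + (P$2$1 + P$2$3) * \<mu> 3) / \<Delta>\<^sub>1,
               (P$3$1 * \<mu> 1 + (P$1$2 + P$1$3) * \<mu> 3) / \<Delta>\<^sub>2,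
               (\<Delta>\<^sub>1 * \<mu> 1 + \<Delta>\<^sub>2 * \<mu> 2 + \<Delta>\<^sub>3 * \<mu> 3) / \<Delta>\<^sub>3]]"
  shows "\<forall>i j. measure M {\<omega> \<in> space M. X 0 \<omega> = i} > 0 \<longrightarrow>
           mean_first_passage_time M X T i j = ennreal (M\<^sub>3 $ i $ j)"
proof (intro allI impI)
  fix i j
  assume pos: "measure M {\<omega> \<in> space M. X 0 \<omega> = i} > 0"
  interpret markov_renewal_process M X T Q
    by fact
  \<comment> \<open>The process determines rows of \<open>P\<close> and values of
    \<open>\<mu>\<close> only at visited states, which by irreducibility are all states.\<close>
  note visited = irreducible_imp_state_visited[OF assms(2,3)]
  have nonneg: "P$r$s \<ge> 0" and stoch: "(\<Sum>s\<in>UNIV. P$r$s) = 1" for r s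
    using visited visited_imp_stochastic[OF assms(2)] by metis+
  have \<mu>_nonneg: "\<mu> s \<ge> 0" for s
    using visited mean_holding_time_nonneg[OF assms(4)] by metis
  have weights: "tree_weights P $ j > 0" for j
    by (intro tree_weights_pos assms(3) nonneg)
  then have nz: "tree_weights P $ j \<noteq> 0" for j
    by (metis less_irrefl)
  \<comment> \<open>The instance for \<open>\<mu>\<close> is the solution sought; the instance for
    the constant 1 is the nonnegative solution that controls survival.\<close>
  have "mean_first_passage_time M X T i j = ennreal (passage_matrix P \<mu> $ i $ j)"
    by (rule mean_first_passage_time_eqI[OF assms(2,4) \<mu>_nonneg
          passage_matrix_solves[OF stoch nz, of \<mu>] passage_matrix_solves[OF stoch nz, of "\<lambda>_. 1"]
          passage_matrix_nonneg[OF nonneg weights] pos]) simp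
  also have "passage_matrix P \<mu> = M\<^sub>3"
    unfolding assms(5-8) passage_matrix_def tree_weights_def Let_def vector_3 ..
  finally show "mean_first_passage_time M X T i j = ennreal (M\<^sub>3 $ i $ j)" .
qed

end
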